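(* For every integer $n \ge 0$, $M(n) \ge p_{\mathbb P}(n)$.
   Context: For a partition $\lambda = (\lambda_1,\dots,\lambda_r)$ of $n$ (positive integer parts summing to $n$), its multinomial coefficient is $\binom{n}{\lambda_1,\dots,\lambda_r} = n!/(\lambda_1!\cdots\lambda_r!)$. $M(n)$ denotes the number of distinct values taken by these multinomial coefficients as $\lambda$ ranges over all partitions of $n$. $p_{\mathbb P}(n)$ denotes the number of partitions of $n$ all of whose parts are prime numbers. *)

theory Defs
  imports "HOL-Library.Multiset" "HOL-Computational_Algebra.Primes"
begin

definition partitions_of :: "nat \<Rightarrow> nat multiset set" where
  "partitions_of n = {L. (\<forall>x \<in># L. 0 < x) \<and> sum_mset L = n}"

text \<open>The division is exact on partitions of \<open>n\<close>: see \<open>multinomial_mset_exact\<close> below.\<close>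

definition multinomial_mset :: "nat \<Rightarrow> nat multiset \<Rightarrow> nat" where
  "multinomial_mset n L = fact n div (\<Prod>x \<in># L. fact x)"

definition num_multinomials :: "nat \<Rightarrow> nat" where
  "num_multinomials n = card (multinomial_mset n ` partitions_of n)"

definition num_prime_partitions :: "nat \<Rightarrow> nat" where
  "num_prime_partitions n = card {L \<in> partitions_of n. \<forall>x \<in># L. prime x}"

lemma prod_fact_dvd_fact_sum: "(\<Prod>x \<in># L. fact x :: nat) dvd fact (sum_mset L)"
proof (induction L)
  case empty
  show ?case by simp
next
  case (add a L)
  have "fact a * (\<Prod>x \<in># L. fact x :: nat) dvd fact a * fact (sum_mset L)"
    using add.IH by (intro mult_dvd_mono) auto
  also have "\<dots> dvd fact (a + sum_mset L)"
    by (rule fact_fact_dvd_fact)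
  finally show ?case by simp
qed

lemma multinomial_mset_exact:
  assumes "L \<in> partitions_of n"
  shows "multinomial_mset n L * (\<Prod>x \<in># L. fact x) = fact n"
  using assms prod_fact_dvd_fact_sum[of L]
  by (auto simp: partitions_of_def multinomial_mset_def)

text \<open>Finiteness of \<^term>\<open>partitions_of n\<close> makes the cardinalities above genuine counts.\<close>

lemma size_le_sum_mset: "(\<forall>x \<in># L. 0 < x) \<Longrightarrow> size L \<le> sum_mset (L :: nat multiset)"
  by (induction L) auto

lemma finite_partitions_of: "finite (partitions_of n)"
proof -
  have "partitions_of n \<subseteq> mset ` {xs. set xs \<subseteq> {..n} \<and> length xs \<le> n}"
  proof
    fix L assume L: "L \<in> partitions_of n"
    obtain xs where xs: "L = mset xs" by (metis ex_mset)
    have "size L \<le> n"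
      using L size_le_sum_mset[of L] by (auto simp: partitions_of_def)
    moreover have "x \<le> n" if "x \<in># L" for x
      using that L by (auto simp: partitions_of_def dest!: multi_member_split)
    ultimately show "L \<in> mset ` {xs. set xs \<subseteq> {..n} \<and> length xs \<le> n}"
      using xs by auto
  qed
  then show ?thesis
    by (rule finite_subset) (intro finite_imageI finite_lists_length_le finite_atMost)
qed

end

theory Submission
  imports Defs
begin

text \<open>
  A multiset of primes is determined by the product of the factorials of its elements. If two such
  multisets have the same product, cancel their common part; a largest prime \<open>p\<close> remaining on one
  side divides some \<open>x!\<close> on the other side, so \<open>p \<le> x\<close>, whence \<open>x = p\<close> by maximality, contradicting
  disjointness. So distinct prime partitions already have distinct multinomial coefficients.
\<close>

lemma prime_dvd_prod_mset_fact_imp_ge: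
  fixes p :: nat
  assumes "prime p" and "p dvd (\<Prod>x \<in># L. fact x)"
  shows "\<exists>x \<in># L. p \<le> x"
  using assms by (auto simp: prime_dvd_prod_mset_iff prime_dvd_fact_iff)

lemma prod_mset_fact_primes_inject:
  fixes L L' :: "nat multiset"
  assumes L: "\<forall>x \<in># L. prime x" and L': "\<forall>x \<in># L'. prime x"
    and eq: "(\<Prod>x \<in># L. fact x :: nat) = (\<Prod>x \<in># L'. fact x)"
  shows "L = L'"
proof (rule ccontr)
  assume "L \<noteq> L'"
  define I where "I = L \<inter># L'"
  define M where "M = L - L'"
  define N where "N = L' - L"
  have LM: "L = I + M" and LN: "L' = I + N"
    by (auto simp: I_def M_def N_def multiset_eq_iff min_def)
  have disj: "set_mset M \<inter> set_mset N = {}"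
    by (auto simp: M_def N_def in_diff_count)
  \<comment> \<open>The factor contributed by \<open>I\<close> is a product of factorials, hence
    nonzero, and cancels.\<close>
  have eqMN: "(\<Prod>x \<in># M. fact x :: nat) = (\<Prod>x \<in># N. fact x)"
    using eq by (auto simp: LM LN prod_mset_zero_iff)
  have ne: "set_mset (M + N) \<noteq> {}"
    using \<open>L \<noteq> L'\<close> by (auto simp: LM LN)
  define p where "p = Max (set_mset (M + N))"
  have p: "p \<in># M + N" and pmax: "\<And>x. x \<in># M + N \<Longrightarrow> x \<le> p"
    using Max_in[OF finite_set_mset ne] Max_ge[OF finite_set_mset] unfolding p_def by blast+
  have "prime p"
    using p L L' by (auto simp: LM LN)
  \<comment> \<open>Kept symmetric in \<open>A\<close> and \<open>B\<close>: whichever of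
    \<open>M\<close> and \<open>N\<close> contains \<open>p\<close>, the other must contain it
    too.\<close>
  have in_both: "p \<in># B"
    if A: "p \<in># A" and AB: "(\<Prod>x \<in># A. fact x :: nat) = (\<Prod>x \<in># B. fact x)" and B: "B \<subseteq># M + N" for A B
  proof -
    have "p dvd fact p"
      using \<open>prime p\<close> by (simp add: prime_dvd_fact_iff)
    also have "fact p dvd (\<Prod>x \<in># A. fact x :: nat)"
      using A by (auto dest!: multi_member_split)
    finally obtain x where "x \<in># B" "p \<le> x"
      using prime_dvd_prod_mset_fact_imp_ge[OF \<open>prime p\<close>, of B] AB by auto
    then show ?thesis
      using pmax[of x] mset_subset_eqD[OF B] by (metis le_antisym)
  qed
  have "p \<in># M \<and> p \<in># N"
    using p in_both[of M N] in_both[of N M] eqMN by auto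
  then show False
    using disj by blast
qed

text \<open>All these coefficients share the numerator \<open>fact n\<close> and the division is
  exact, so equal coefficients force equal denominators, which determine a multiset of
  primes.\<close>

lemma inj_on_multinomial_mset_primes:
  "inj_on (multinomial_mset n) {L \<in> partitions_of n. \<forall>x \<in># L. prime x}"
proof (rule inj_onI, clarify)
  fix L L'
  assume part: "L \<in> partitions_of n" "L' \<in> partitions_of n"
    and primes: "\<forall>x \<in># L. prime x" "\<forall>x \<in># L'. prime x"
    and eq: "multinomial_mset n L = multinomial_mset n L'"
  have "multinomial_mset n L' * (\<Prod>x \<in># L. fact x) = multinomial_mset n L' * (\<Prod>x \<in># L'. fact x)"
    using multinomial_mset_exact[OF part(1)] multinomial_mset_exact[OF part(2)] eq by simp
  \<comment> \<open>A zero coefficient would make \<open>fact n\<close> zero; hence the common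
    factor can be cancelled.\<close>
  moreover have "multinomial_mset n L' \<noteq> 0"
    using multinomial_mset_exact[OF part(2)] by (metis fact_nonzero mult_zero_left)
  ultimately show "L = L'"
    using prod_mset_fact_primes_inject[OF primes] by simp
qed

theorem theorem1:
  fixes n :: nat
  shows "num_multinomials n \<ge> num_prime_partitions n"
  unfolding num_multinomials_def num_prime_partitions_def
  by (rule card_inj_on_le[OF inj_on_multinomial_mset_primes])
    (auto intro: finite_partitions_of)

end
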